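(* Consider the multi-criteria problem with feasible set $S$ and real-valued criteria $F_1,\dots,F_n$ (each to be maximized or minimized), with best values $K_i$ and worst values $W_i$, and consider the associated two-criteria problem over $\vec X\in S$: $$\Delta(\vec X)=\sqrt{\sum_{i=1}^n[K_i-F_i(\vec X)]^2}\to\min,\qquad \theta(\vec X)=\sqrt{\sum_{i=1}^n[W_i-F_i(\vec X)]^2}\to\max .$$ If $\vec X^*\in S$ is a lexicographically optimal solution of the two-criteria problem for either of the two lexicographic criteria orders $\pi_1=\{\Delta,\theta\}$ or $\pi_2=\{\theta,\Delta\}$, then $\vec X^*$ is a Pareto-optimal solution of the original multi-criteria problem with criteria $F_1,\dots,F_n$.
   Context: Multi-criteria problem: vectors of variables are $\vec X=(x_1,\dots,x_m)$ with $x_k\in X_k$ for given sets $X_k$, subject to restrictions $\varphi_j(\vec X)\le b_j$ for all $j$, where the $\varphi_j$ are real-valued functions and the $b_j$ are real numbers. The feasible set $S$ is the set of all such $\vec X$ satisfying all restrictions. There are $n\ge 1$ real-valued criteria $F_i(\vec X)$, $i\in I=\{1,\dots,n\}$, and for each $i$ it is specified whether $F_i$ is to be maximized or minimized. Best and worst values: if $F_i$ is to be maximized, then $K_i=\max_{S}F_i$ and $W_i=\min_{S}F_i$; if $F_i$ is to be minimized, then $K_i=\min_{S}F_i$ and $W_i=\max_{S}F_i$. Standing assumptions: these extrema exist, and $K_i\ne W_i$ for every $i$. The points $(K_1,\dots,K_n)$ and $(W_1,\dots,W_n)$ of criteria space need not be attained by a feasible vector. Pareto-optimality: $\vec X\in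 S$ is Pareto-optimal if there is no $\vec X'\in S$ such that, for every $i$, $F_i(\vec X')$ is at least as good as $F_i(\vec X)$ (that is, $\ge$ if $F_i$ is maximized, $\le$ if $F_i$ is minimized), with strict improvement for at least one $i$. Lexicographic optimality: $\vec X^*$ is lexicographically optimal for the order $\pi_1=\{\Delta,\theta\}$ if $\vec X^*$ minimizes $\Delta$ over $S$ and, among all minimizers of $\Delta$ over $S$, maximizes $\theta$. It is lexicographically optimal for the order $\pi_2=\{\theta,\Delta\}$ if $\vec X^*$ maximizes $\theta$ over $S$ and, among all maximizers of $\theta$ over $S$, minimizes $\Delta$. *)

theory Defs
  imports Complex_Main "HOL-Library.FuncSet"
begin

text \<open>
  A vector \<open>(x\<^sub>1, \<dots>, x\<^sub>m)\<close> is a function on \<open>{1..m}\<close> that is \<^const>\<open>undefined\<close> elsewhere.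
  The sets \<open>X 1, \<dots>, X m\<close> may be arbitrary subsets of a common type.
\<close>

definition feasible_set ::
  "nat \<Rightarrow> (nat \<Rightarrow> 'a set) \<Rightarrow> 'j set \<Rightarrow> ('j \<Rightarrow> (nat \<Rightarrow> 'a) \<Rightarrow> real) \<Rightarrow> ('j \<Rightarrow> real) \<Rightarrow> (nat \<Rightarrow> 'a) set"
  where "feasible_set m X J \<phi> b = {x \<in> (\<Pi>\<^sub>E k\<in>{1..m}. X k). \<forall>j\<in>J. \<phi> j x \<le> b j}"

datatype direction = Maximize | Minimize

fun at_least_as_good :: "direction \<Rightarrow> real \<Rightarrow> real \<Rightarrow> bool" where
  "at_least_as_good Maximize u v \<longleftrightarrow> u \<ge> v"
| "at_least_as_good Minimize u v \<longleftrightarrow> u \<le> v"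

fun strictly_better :: "direction \<Rightarrow> real \<Rightarrow> real \<Rightarrow> bool" where
  "strictly_better Maximize u v \<longleftrightarrow> u > v"
| "strictly_better Minimize u v \<longleftrightarrow> u < v"

text \<open>
  \<^const>\<open>Max\<close> and \<^const>\<open>Min\<close> are only meaningful for finite sets, so extrema over an arbitrary
  set are written with \<open>GREATEST\<close> and \<open>LEAST\<close>. The values below are unspecified unless the
  extremum is attained.
\<close>

definition max_value :: "'v set \<Rightarrow> ('v \<Rightarrow> real) \<Rightarrow> real"
  where "max_value S f = (GREATEST u. u \<in> f ` S)"

definition min_value :: "'v set \<Rightarrow> ('v \<Rightarrow> real) \<Rightarrow> real"
  where "min_value S f = (LEAST u. u \<in> f ` S)"

fun best_value :: "direction \<Rightarrow> 'v set \<Rightarrow> ('v \<Rightarrow> real) \<Rightarrow> real" where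
  "best_value Maximize S f = max_value S f"
| "best_value Minimize S f = min_value S f"

fun worst_value :: "direction \<Rightarrow> 'v set \<Rightarrow> ('v \<Rightarrow> real) \<Rightarrow> real" where
  "worst_value Maximize S f = min_value S f"
| "worst_value Minimize S f = max_value S f"

definition pareto_optimal ::
  "nat \<Rightarrow> (nat \<Rightarrow> direction) \<Rightarrow> 'v set \<Rightarrow> (nat \<Rightarrow> 'v \<Rightarrow> real) \<Rightarrow> 'v \<Rightarrow> bool"
  where "pareto_optimal n dir S F x \<longleftrightarrow> x \<in> S \<and>
    \<not> (\<exists>x'\<in>S. (\<forall>i\<in>{1..n}. at_least_as_good (dir i) (F i x') (F i x)) \<and>
               (\<exists>i\<in>{1..n}. strictly_better (dir i) (F i x') (F i x)))"

text \<open>The Euclidean distance in criteria space from \<open>(c 1, \<dots>, c n)\<close> to the image of \<open>x\<close>.\<close>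

definition criteria_distance ::
  "nat \<Rightarrow> (nat \<Rightarrow> real) \<Rightarrow> (nat \<Rightarrow> 'v \<Rightarrow> real) \<Rightarrow> 'v \<Rightarrow> real"
  where "criteria_distance n c F x = sqrt (\<Sum>i=1..n. (c i - F i x)\<^sup>2)"

definition lex_optimal_min_max :: "'v set \<Rightarrow> ('v \<Rightarrow> real) \<Rightarrow> ('v \<Rightarrow> real) \<Rightarrow> 'v \<Rightarrow> bool"
  where "lex_optimal_min_max S f g x \<longleftrightarrow> is_arg_max g (\<lambda>y. is_arg_min f (\<lambda>z. z \<in> S) y) x"

definition lex_optimal_max_min :: "'v set \<Rightarrow> ('v \<Rightarrow> real) \<Rightarrow> ('v \<Rightarrow> real) \<Rightarrow> 'v \<Rightarrow> bool"
  where "lex_optimal_max_min S f g x \<longleftrightarrow> is_arg_min g (\<lambda>y. is_arg_max f (\<lambda>z. z \<in> S) y) x"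

end

theory Submission
  imports Defs
begin

text \<open>
  Every coordinate \<open>F i x\<close> of the image of a feasible vector lies between the worst value \<open>W i\<close>
  and the best value \<open>K i\<close>. On this segment, moving a criterion in its direction of improvement
  shortens the distance to \<open>K i\<close> and lengthens the distance to \<open>W i\<close>, so a feasible vector that
  Pareto-dominates another is strictly closer to the ideal point \<open>K\<close> \<^emph>\<open>and\<close> strictly farther from
  the anti-ideal point \<open>W\<close> (\<open>dominating_closer_to_best\<close>, \<open>dominating_farther_from_worst\<close>).
  Hence a dominated vector can neither minimize \<open>\<Delta>\<close> nor maximize \<open>\<theta>\<close> over \<open>S\<close>. A lexicographic
  optimum optimizes the leading criterion of its order over all of \<open>S\<close>, so it is undominated
  whichever of the two orders is chosen.
\<close>

lemma le_max_value:
  assumes "\<exists>x\<in>S. \<forall>y\<in>S. f y \<le> f x" and "y \<in> S"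
  shows "f y \<le> max_value S f"
proof -
  obtain x where "x \<in> S" "\<forall>y\<in>S. f y \<le> f x" using assms(1) by blast
  then have "max_value S f = f x"
    unfolding max_value_def by (intro Greatest_equality) auto
  then show ?thesis using \<open>\<forall>y\<in>S. f y \<le> f x\<close> assms(2) by simp
qed

lemma min_value_le:
  assumes "\<exists>x\<in>S. \<forall>y\<in>S. f x \<le> f y" and "y \<in> S"
  shows "min_value S f \<le> f y"
proof -
  obtain x where "x \<in> S" "\<forall>y\<in>S. f x \<le> f y" using assms(1) by blast
  then have "min_value S f = f x"
    unfolding min_value_def by (intro Least_equality) auto
  then show ?thesis using \<open>\<forall>y\<in>S. f x \<le> f y\<close> assms(2) by simp
qed

lemma best_value_at_least_as_good:
  assumes "\<exists>x\<in>S. \<forall>y\<in>S. f y \<le> f x" and "\<exists>x\<in>S. \<forall>y\<in>S. f x \<le> f y" and "y \<in> S"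
  shows "at_least_as_good d (best_value d S f) (f y)"
  using le_max_value[OF assms(1,3)] min_value_le[OF assms(2,3)] by (cases d) simp_all

lemma at_least_as_good_worst_value:
  assumes "\<exists>x\<in>S. \<forall>y\<in>S. f y \<le> f x" and "\<exists>x\<in>S. \<forall>y\<in>S. f x \<le> f y" and "y \<in> S"
  shows "at_least_as_good d (f y) (worst_value d S f)"
  using le_max_value[OF assms(1,3)] min_value_le[OF assms(2,3)] by (cases d) simp_all

lemma criteria_distance_strict_mono:
  assumes "\<And>i. i \<in> {1..n} \<Longrightarrow> \<bar>c i - F i x\<bar> \<le> \<bar>c i - F i y\<bar>"
    and "\<exists>i\<in>{1..n}. \<bar>c i - F i x\<bar> < \<bar>c i - F i y\<bar>"
  shows "criteria_distance n c F x < criteria_distance n c F y"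
proof -
  have "(\<Sum>i=1..n. (c i - F i x)\<^sup>2) < (\<Sum>i=1..n. (c i - F i y)\<^sup>2)"
  proof (rule sum_strict_mono_ex1)
    show "\<forall>i\<in>{1..n}. (c i - F i x)\<^sup>2 \<le> (c i - F i y)\<^sup>2"
      using assms(1) by (simp add: abs_le_square_iff)
    show "\<exists>i\<in>{1..n}. (c i - F i x)\<^sup>2 < (c i - F i y)\<^sup>2"
      using assms(2) by (metis abs_le_square_iff not_le)
  qed simp
  then show ?thesis by (simp add: criteria_distance_def)
qed

text \<open>
  When all values are on the bad side of the reference point \<open>c\<close>, the absolute values in
  \<open>\<bar>c i - F i x\<bar>\<close> open with the same sign for both vectors, so domination compares the summands of
  the distance one by one. This would fail if an improvement could overshoot \<open>c i\<close>.
\<close>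

lemma dominating_closer_to_best:
  assumes bound: "\<And>i. i \<in> {1..n} \<Longrightarrow> at_least_as_good (dir i) (c i) (F i x')"
    and ge: "\<And>i. i \<in> {1..n} \<Longrightarrow> at_least_as_good (dir i) (F i x') (F i x)"
    and gt: "\<exists>i\<in>{1..n}. strictly_better (dir i) (F i x') (F i x)"
  shows "criteria_distance n c F x' < criteria_distance n c F x"
proof (rule criteria_distance_strict_mono)
  show "\<bar>c i - F i x'\<bar> \<le> \<bar>c i - F i x\<bar>" if "i \<in> {1..n}" for i
    using bound[OF that] ge[OF that] by (cases "dir i") simp_all
  obtain i where i: "i \<in> {1..n}" "strictly_better (dir i) (F i x') (F i x)" using gt by blast
  have "\<bar>c i - F i x'\<bar> < \<bar>c i - F i x\<bar>"
    using bound[OF i(1)] i(2) by (cases "dir i") simp_all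
  then show "\<exists>i\<in>{1..n}. \<bar>c i - F i x'\<bar> < \<bar>c i - F i x\<bar>" using i(1) by blast
qed

text \<open>
  The mirror image: here it is the dominated vector that has to be on the good side of \<open>c\<close>,
  since the dominating one is then even farther out on that side.
\<close>

lemma dominating_farther_from_worst:
  assumes bound: "\<And>i. i \<in> {1..n} \<Longrightarrow> at_least_as_good (dir i) (F i x) (c i)"
    and ge: "\<And>i. i \<in> {1..n} \<Longrightarrow> at_least_as_good (dir i) (F i x') (F i x)"
    and gt: "\<exists>i\<in>{1..n}. strictly_better (dir i) (F i x') (F i x)"
  shows "criteria_distance n c F x < criteria_distance n c F x'"
proof (rule criteria_distance_strict_mono)
  show "\<bar>c i - F i x\<bar> \<le> \<bar>c i - F i x'\<bar>" if "i \<in> {1..n}" for i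
    using bound[OF that] ge[OF that] by (cases "dir i") simp_all
  obtain i where i: "i \<in> {1..n}" "strictly_better (dir i) (F i x') (F i x)" using gt by blast
  have "\<bar>c i - F i x\<bar> < \<bar>c i - F i x'\<bar>"
    using bound[OF i(1)] i(2) by (cases "dir i") simp_all
  then show "\<exists>i\<in>{1..n}. \<bar>c i - F i x\<bar> < \<bar>c i - F i x'\<bar>" using i(1) by blast
qed

theorem theorem3:
  fixes m n :: nat
    and X :: "nat \<Rightarrow> 'a set"
    and J :: "'j set"
    and \<phi> :: "'j \<Rightarrow> (nat \<Rightarrow> 'a) \<Rightarrow> real"
    and b :: "'j \<Rightarrow> real"
    and S :: "(nat \<Rightarrow> 'a) set"
    and F :: "nat \<Rightarrow> (nat \<Rightarrow> 'a) \<Rightarrow> real"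
    and dir :: "nat \<Rightarrow> direction"
    and K W :: "nat \<Rightarrow> real"
    and \<Delta> \<theta> :: "(nat \<Rightarrow> 'a) \<Rightarrow> real"
    and xs :: "nat \<Rightarrow> 'a"
  assumes "n \<ge> 1"
    and "S = feasible_set m X J \<phi> b"
    and "\<And>i. i \<in> {1..n} \<Longrightarrow> \<exists>x\<in>S. \<forall>y\<in>S. F i y \<le> F i x"
    and "\<And>i. i \<in> {1..n} \<Longrightarrow> \<exists>x\<in>S. \<forall>y\<in>S. F i x \<le> F i y"
    and "\<And>i. i \<in> {1..n} \<Longrightarrow> K i = best_value (dir i) S (F i)"
    and "\<And>i. i \<in> {1..n} \<Longrightarrow> W i = worst_value (dir i) S (F i)"
    and "\<And>i. i \<in> {1..n} \<Longrightarrow> K i \<noteq> W i"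
    and "\<And>x. \<Delta> x = criteria_distance n K F x"
    and "\<And>x. \<theta> x = criteria_distance n W F x"
    and "xs \<in> S"
    and "lex_optimal_min_max S \<Delta> \<theta> xs \<or> lex_optimal_max_min S \<theta> \<Delta> xs"
  shows "pareto_optimal n dir S F xs"
proof -
  have "\<not> (\<exists>x'\<in>S. (\<forall>i\<in>{1..n}. at_least_as_good (dir i) (F i x') (F i xs)) \<and>
               (\<exists>i\<in>{1..n}. strictly_better (dir i) (F i x') (F i xs)))"
  proof
    assume "\<exists>x'\<in>S. (\<forall>i\<in>{1..n}. at_least_as_good (dir i) (F i x') (F i xs)) \<and>
               (\<exists>i\<in>{1..n}. strictly_better (dir i) (F i x') (F i xs))"
    then obtain x' where "x' \<in> S"
      and ge: "\<And>i. i \<in> {1..n} \<Longrightarrow> at_least_as_good (dir i) (F i x') (F i xs)"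
      and gt: "\<exists>i\<in>{1..n}. strictly_better (dir i) (F i x') (F i xs)"
      by blast
    have best: "at_least_as_good (dir i) (K i) (F i x')" if "i \<in> {1..n}" for i
      using best_value_at_least_as_good[OF assms(3,4)[OF that] \<open>x' \<in> S\<close>] assms(5)[OF that] by simp
    have closer: "\<Delta> x' < \<Delta> xs"
      unfolding assms(8)
      by (rule dominating_closer_to_best[where dir = dir and F = F, OF best ge gt])
    have worst: "at_least_as_good (dir i) (F i xs) (W i)" if "i \<in> {1..n}" for i
      using at_least_as_good_worst_value[OF assms(3,4)[OF that] \<open>xs \<in> S\<close>] assms(6)[OF that] by simp
    have farther: "\<theta> xs < \<theta> x'"
      unfolding assms(9)
      by (rule dominating_farther_from_worst[where dir = dir and F = F, OF worst ge gt])
    from assms(11) have "is_arg_min \<Delta> (\<lambda>z. z \<in> S) xs \<or> is_arg_max \<theta> (\<lambda>z. z \<in> S) xs"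
      unfolding lex_optimal_min_max_def lex_optimal_max_min_def
      by (auto simp: is_arg_max_def[of _ "\<lambda>y. is_arg_min _ _ y"]
          is_arg_min_def[of _ "\<lambda>y. is_arg_max _ _ y"])
    then show False
      using closer farther \<open>x' \<in> S\<close> by (auto simp: is_arg_min_def is_arg_max_def)
  qed
  then show ?thesis using \<open>xs \<in> S\<close> by (simp add: pareto_optimal_def)
qed

end
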